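(* Let $(\bar{\mathbf{V}}^t,\mathbf{X}^{t+1})_{t\ge0}$ be generated by the algorithm OBCD described in the context, applied to $\min_{\mathbf{X}\in\mathrm{St}(n,r)}F(\mathbf{X})$ with feasible starting point $\mathbf{X}^0$ and proximal parameter $\alpha>0$. Let $F_\infty=\inf_{\mathbf{X}\in\mathrm{St}(n,r)}F(\mathbf{X})>-\infty$ and $\tilde c\triangleq\tfrac{2}{\alpha}(F(\mathbf{X}^0)-F_\infty)\ge0$. Then: (a) For all $t\ge0$, $$\tfrac{\alpha}{2}\|\mathbf{X}^{t+1}-\mathbf{X}^t\|_{\mathsf F}^2\le\tfrac{\alpha}{2}\|\bar{\mathbf{V}}^t-\mathrm{I}_k\|_{\mathsf F}^2\le F(\mathbf{X}^t)-F(\mathbf{X}^{t+1}).$$ (b) If each $\mathtt{B}^t$ is selected from $\{\mathcal{B}_i\}_{i=1}^{\mathrm{C}_n^k}$ randomly and uniformly, then for every $\epsilon>0$ OBCD finds an $\epsilon$-$\mathrm{BS}_k$-point in at most $T$ iterations in the sense of expectation, provided $T\ge\tilde c/\epsilon$; that is, there is an index $\bar t\in\{0,\dots,T\}$ with $$\mathbb{E}\Big[\tfrac{1}{\mathrm{C}_n^k}\sum_{i=1}^{\mathrm{C}_n^k}\mathrm{dist}\big(\mathrm{I}_k,\arg\min_{\mathbf{V}\in\mathrm{St}(k,k)}\mathcal{K}(\mathbf{V};\mathbf{X}^{\bar t},\mathcal{B}_i)\big)^2\Big]\le\epsilon.$$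
   Context: Notation: $\mathrm{St}(n,r)=\{\mathbf{X}\in\mathbb{R}^{n\times r}:\mathbf{X}^{\mathsf T}\mathbf{X}=\mathrm{I}_r\}$, $n\ge r$, $n\ge2$, block size $k\ge2$. $\mathrm{C}_n^k=\binom nk$ and $\{\mathcal{B}_1,\dots,\mathcal{B}_{\mathrm{C}_n^k}\}$ is the set of all index vectors choosing $k$ items from $\{1,\dots,n\}$ without repetition. For $\mathtt{B}\in\{\mathcal{B}_i\}$ with complement $\mathtt{B}^c$, $\mathrm{U}_{\mathtt{B}}\in\mathbb{R}^{n\times k}$ has $(\mathrm{U}_{\mathtt{B}})_{ji}=1$ if $\mathtt{B}_i=j$ and $0$ otherwise; $\mathrm{U}_{\mathtt{B}^c}$ is defined likewise; $[\mathbf{A}]_{\mathtt{B}\mathtt{B}}=\mathrm{U}_{\mathtt{B}}^{\mathsf T}\mathbf{A}\mathrm{U}_{\mathtt{B}}$. $\|\mathbf{Y}\|_{\mathbf{H}}^2\triangleq\mathrm{vec}(\mathbf{Y})^{\mathsf T}\mathbf{H}\,\mathrm{vec}(\mathbf{Y})$, $\|\cdot\|_{\mathsf{sp}}$ is the spectral norm, $\|\cdot\|_{\mathsf F}$ the Frobenius norm, $\mathrm{dist}$ the Frobenius distance (infimum) between sets. Standing assumptions: $F=f+h$. (i) $f:\mathbb{R}^{n\times r}\to\mathbb{R}$ is differentiable and there is $\mathbf{H}\in\mathbb{R}^{nr\times nr}$ with $\|\mathbf{H}\|_{\mathsf{sp}}\le L_f$, $L_f>0$, such that $f(\mathbf{X}^+)\le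 f(\mathbf{X})+\langle\mathbf{X}^+-\mathbf{X},\nabla f(\mathbf{X})\rangle+\tfrac12\|\mathbf{X}^+-\mathbf{X}\|_{\mathbf{H}}^2$ for all $\mathbf{X},\mathbf{X}^+$ differing in at most $k$ rows. (ii) $h$ is proper, lower semicontinuous, and coordinate-wise separable: $h(\mathbf{X})=\sum_{i,j}h(\mathbf{X}_{ij})$ (same notation for matrices of any size). (iii) The subproblems below can be solved to global optimality. Majorizer: for $\mathbf{X}\in\mathrm{St}(n,r)$ and $\mathtt{B}$, put $\mathbf{Z}=\mathrm{U}_{\mathtt{B}}^{\mathsf T}\mathbf{X}$, $\underline{\mathbf{Q}}=(\mathbf{Z}^{\mathsf T}\otimes\mathrm{U}_{\mathtt{B}})^{\mathsf T}\mathbf{H}(\mathbf{Z}^{\mathsf T}\otimes\mathrm{U}_{\mathtt{B}})$, and let $\mathbf{Q}$ be either $\underline{\mathbf{Q}}$, or $\varsigma\mathrm{I}$ with $\|\underline{\mathbf{Q}}\|_{\mathsf{sp}}\le\varsigma\le L_f$. Then $\mathcal{K}(\mathbf{V};\mathbf{X},\mathtt{B})=\tfrac12\|\mathbf{V}-\mathrm{I}_k\|_{\mathbf{Q}+\alpha\mathrm{I}}^2+\langle\mathbf{V},[\nabla f(\mathbf{X})\mathbf{X}^{\mathsf T}]_{\mathtt{B}\mathtt{B}}\rangle+h(\mathbf{V}\mathrm{U}_{\mathtt{B}}^{\mathsf T}\mathbf{X})+\ddot c$, with $\ddot c=f(\mathbf{X})+h(\mathrm{U}_{\mathtt{B}^c}^{\mathsf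 T}\mathbf{X})-\langle\mathrm{I}_k,[\nabla f(\mathbf{X})\mathbf{X}^{\mathsf T}]_{\mathtt{B}\mathtt{B}}\rangle$. Algorithm OBCD: start from $\mathbf{X}^0\in\mathrm{St}(n,r)$. For $t=0,1,2,\dots$: select a working set $\mathtt{B}^t\in\{\mathcal{B}_i\}$ (uniformly at random, independently of the past); compute a global minimizer $\bar{\mathbf{V}}^t\in\arg\min_{\mathbf{V}\in\mathrm{St}(k,k)}\mathcal{K}(\mathbf{V};\mathbf{X}^t,\mathtt{B}^t)$; set $\mathbf{X}^{t+1}=\mathbf{X}^t+\mathrm{U}_{\mathtt{B}^t}(\bar{\mathbf{V}}^t-\mathrm{I}_k)\mathrm{U}_{\mathtt{B}^t}^{\mathsf T}\mathbf{X}^t$ (only the rows in $\mathtt{B}^t$ change). Definition: for $\epsilon>0$, $\ddot{\mathbf{X}}$ is an $\epsilon$-$\mathrm{BS}_k$-point if $\tfrac{1}{\mathrm{C}_n^k}\sum_{i=1}^{\mathrm{C}_n^k}\mathrm{dist}(\mathrm{I}_k,\arg\min_{\mathbf{V}\in\mathrm{St}(k,k)}\mathcal{K}(\mathbf{V};\ddot{\mathbf{X}},\mathcal{B}_i))^2\le\epsilon$. *)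

theory Defs
  imports "HOL-Probability.Probability"
begin

text \<open>
  A matrix with rows indexed by \<open>'n\<close> and columns indexed by \<open>'r\<close> has type
  \<open>real^'r^'n\<close>; the \<open>norm\<close>, \<open>inner\<close> and distance of this type are the
  Frobenius ones. The synonym below, with the row index first, denotes the same type; unlike
  \<open>^\<close> it allows index variables of the sort \<open>{finite,linorder}\<close>, as needed for the ordered index sets.
\<close>

type_synonym ('n, 'r) rmat = "((real, 'r) vec, 'n) vec"

definition St :: "(real^'r^'n) set" where
  "St = {X. transpose X ** X = mat 1}"

text \<open>
  Each choice of \<open>k\<close> indices out of \<open>{1,...,n}\<close> is listed exactly once, as an increasing
  index vector, so there are \<open>n choose k\<close> of them.
\<close>

definition blocks :: "('k::{finite,linorder} \<Rightarrow> 'n::{finite,linorder}) set" where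
  "blocks = {B. strict_mono B}"

definition U :: "('k \<Rightarrow> 'n) \<Rightarrow> real^'k^'n" where
  "U B = (\<chi> j i. if B i = j then 1 else 0)"

definition subblock :: "('k::finite \<Rightarrow> 'n::finite) \<Rightarrow> real^'n^'n \<Rightarrow> real^'k^'k" where
  "subblock B A = transpose (U B) ** A ** U B"

text \<open>
  Column-stacking vectorisation: the index pairs are (column, row), so that
  \<open>vectorize (A ** Y ** C) = kron (transpose C) A *v vectorize Y\<close>.
\<close>

definition vectorize :: "real^'c^'r \<Rightarrow> real^('c \<times> 'r)" where
  "vectorize Y = (\<chi> p. Y $ snd p $ fst p)"

definition kron :: "real^'b^'a \<Rightarrow> real^'d^'c \<Rightarrow> real^('b \<times> 'd)^('a \<times> 'c)" where
  "kron A C = (\<chi> p q. A $ fst p $ fst q * C $ snd p $ snd q)"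

definition sqnorm_wrt :: "real^('c \<times> 'r)^('c \<times> 'r) \<Rightarrow> real^'c^'r \<Rightarrow> real" where
  "sqnorm_wrt H Y = vectorize Y \<bullet> (H *v vectorize Y)"

definition spectral_norm :: "real^'m^'l \<Rightarrow> real" where
  "spectral_norm A = onorm ((*v) A)"

definition proper :: "('a \<Rightarrow> ereal) \<Rightarrow> bool" where
  "proper g \<longleftrightarrow> (\<exists>x. g x < \<infinity>) \<and> (\<forall>x. g x \<noteq> -\<infinity>)"

definition lower_semicontinuous :: "('a::topological_space \<Rightarrow> ereal) \<Rightarrow> bool" where
  "lower_semicontinuous g \<longleftrightarrow> (\<forall>x. g x \<le> Liminf (at x) g)"

text \<open>The separable extension of a scalar function to matrices of any size.\<close>

definition sep :: "(real \<Rightarrow> ereal) \<Rightarrow> real^'c^'r \<Rightarrow> ereal" where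
  "sep h Y = (\<Sum>i\<in>UNIV. \<Sum>j\<in>UNIV. h (Y $ i $ j))"

text \<open>
  The value of \<open>sep h\<close> at the matrix formed by the rows of \<open>X\<close> outside the block \<open>B\<close>, that is
  \<open>h(U_{B^c}^T X)\<close>; there is no type with \<open>n - k\<close> elements to index the rows of \<open>U_{B^c}^T X\<close>.
\<close>

definition sep_compl ::
    "(real \<Rightarrow> ereal) \<Rightarrow> ('k \<Rightarrow> 'n) \<Rightarrow> real^'r^'n \<Rightarrow> ereal" where
  "sep_compl h B X = (\<Sum>i\<in>- range B. \<Sum>j\<in>UNIV. h (X $ i $ j))"

definition objective ::
    "(real^'r^'n \<Rightarrow> real) \<Rightarrow> (real \<Rightarrow> ereal) \<Rightarrow> real^'r^'n \<Rightarrow> ereal" where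
  "objective f h X = ereal (f X) + sep h X"

definition Q_lower ::
    "real^('r \<times> 'n)^('r \<times> 'n) \<Rightarrow> real^'r^'n \<Rightarrow> ('k::finite \<Rightarrow> 'n::finite)
      \<Rightarrow> real^('k \<times> 'k)^('k \<times> 'k)" where
  "Q_lower H X B =
    (let Z = transpose (U B) ** X; K = kron (transpose Z) (U B)
     in transpose K ** H ** K)"

text \<open>\<open>Q X B\<close> is the matrix used in the majorizer at \<open>X\<close> for the block \<open>B\<close>.\<close>

definition admissible_Q ::
    "('r::finite \<times> 'n::{finite,linorder}, 'r \<times> 'n) rmat \<Rightarrow> real
      \<Rightarrow> (('n, 'r) rmat \<Rightarrow> ('k::{finite,linorder} \<Rightarrow> 'n) \<Rightarrow> ('k \<times> 'k, 'k \<times> 'k) rmat)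
      \<Rightarrow> bool" where
  "admissible_Q H L Q \<longleftrightarrow>
    (\<forall>X\<in>St. \<forall>B\<in>blocks.
       Q X B = Q_lower H X B \<or>
       (\<exists>\<sigma>. spectral_norm (Q_lower H X B) \<le> \<sigma> \<and> \<sigma> \<le> L \<and> Q X B = \<sigma> *\<^sub>R mat 1))"

definition majorizer ::
    "(real^'r^'n \<Rightarrow> real) \<Rightarrow> (real^'r^'n \<Rightarrow> real^'r^'n) \<Rightarrow> (real \<Rightarrow> ereal)
      \<Rightarrow> (real^'r^'n \<Rightarrow> ('k::finite \<Rightarrow> 'n::finite) \<Rightarrow> real^('k \<times> 'k)^('k \<times> 'k)) \<Rightarrow> real
      \<Rightarrow> real^'r^'n \<Rightarrow> ('k \<Rightarrow> 'n) \<Rightarrow> real^'k^'k \<Rightarrow> ereal" where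
  "majorizer f gradf h Q \<alpha> X B V =
    (let D = subblock B (gradf X ** transpose X);
         c = ereal (f X) + sep_compl h B X - ereal (mat 1 \<bullet> D)
     in ereal (1/2 * sqnorm_wrt (Q X B + \<alpha> *\<^sub>R mat 1) (V - mat 1)) + ereal (V \<bullet> D)
        + sep h (V ** transpose (U B) ** X) + c)"

definition argmin_V ::
    "(real^'r^'n \<Rightarrow> real) \<Rightarrow> (real^'r^'n \<Rightarrow> real^'r^'n) \<Rightarrow> (real \<Rightarrow> ereal)
      \<Rightarrow> (real^'r^'n \<Rightarrow> ('k::finite \<Rightarrow> 'n::finite) \<Rightarrow> real^('k \<times> 'k)^('k \<times> 'k)) \<Rightarrow> real
      \<Rightarrow> real^'r^'n \<Rightarrow> ('k \<Rightarrow> 'n) \<Rightarrow> (real^'k^'k) set" where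
  "argmin_V f gradf h Q \<alpha> X B = {V. is_arg_min (majorizer f gradf h Q \<alpha> X B) (\<lambda>V. V \<in> St) V}"

definition obcd_run ::
    "(('n::{finite,linorder}, 'r::finite) rmat \<Rightarrow> real)
      \<Rightarrow> (('n, 'r) rmat \<Rightarrow> ('n, 'r) rmat)
      \<Rightarrow> (real \<Rightarrow> ereal)
      \<Rightarrow> (('n, 'r) rmat \<Rightarrow> ('k::{finite,linorder} \<Rightarrow> 'n) \<Rightarrow> ('k \<times> 'k, 'k \<times> 'k) rmat) \<Rightarrow> real
      \<Rightarrow> ('n, 'r) rmat \<Rightarrow> (nat \<Rightarrow> 'k \<Rightarrow> 'n)
      \<Rightarrow> (nat \<Rightarrow> ('k, 'k) rmat) \<Rightarrow> (nat \<Rightarrow> ('n, 'r) rmat) \<Rightarrow> bool" where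
  "obcd_run f gradf h Q \<alpha> X0 B V X \<longleftrightarrow>
    X 0 = X0 \<and>
    (\<forall>t. B t \<in> blocks \<and>
         V t \<in> argmin_V f gradf h Q \<alpha> (X t) (B t) \<and>
         X (Suc t) = X t + U (B t) ** (V t - mat 1) ** transpose (U (B t)) ** X t)"

text \<open>A point \<open>X\<close> is an \<open>\<epsilon>\<close>-\<open>BS_k\<close>-point iff its \<open>BS_gap\<close> is at most \<open>\<epsilon>\<close>.\<close>

definition BS_gap ::
    "(('n::{finite,linorder}, 'r::finite) rmat \<Rightarrow> real)
      \<Rightarrow> (('n, 'r) rmat \<Rightarrow> ('n, 'r) rmat)
      \<Rightarrow> (real \<Rightarrow> ereal)
      \<Rightarrow> (('n, 'r) rmat \<Rightarrow> ('k::{finite,linorder} \<Rightarrow> 'n)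
            \<Rightarrow> ('k \<times> 'k, 'k \<times> 'k) rmat) \<Rightarrow> real
      \<Rightarrow> ('n, 'r) rmat \<Rightarrow> real" where
  "BS_gap f gradf h Q \<alpha> X =
    1 / real (CARD('n) choose CARD('k)) *
      (\<Sum>B\<in>blocks. (infdist (mat 1) (argmin_V f gradf h Q \<alpha> X B))\<^sup>2)"

text \<open>
  \<open>\<F> t\<close> represents everything that happened before the block \<open>B t\<close> is drawn.
  The minimizers may be picked by any rule, possibly itself randomised, that does not look ahead.
\<close>

definition uniform_selection ::
    "'w measure \<Rightarrow> (nat \<Rightarrow> 'w measure)
      \<Rightarrow> (nat \<Rightarrow> 'w \<Rightarrow> 'k::{finite,linorder} \<Rightarrow> 'n::{finite,linorder}) \<Rightarrow> bool" where
  "uniform_selection M \<F> B \<longleftrightarrow>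
    (\<forall>t. B t \<in> M \<rightarrow>\<^sub>M count_space blocks \<and>
         distr M (count_space blocks) (B t) = uniform_count_measure blocks \<and>
         prob_space.indep_set M
           (sets (vimage_algebra (space M) (B t) (count_space blocks))) (sets (\<F> t)))"

text \<open>
  The measurability of \<open>Q\<close> along the iterates is automatic when \<open>Q\<close> is always \<open>Q_lower\<close>,
  when \<open>Q\<close> is a fixed multiple of the identity for each block, and when \<open>\<F> t\<close> is generated
  by \<open>B 0, ..., B (t - 1)\<close>.
\<close>

definition nonanticipating ::
    "'w measure \<Rightarrow> (nat \<Rightarrow> 'w measure)
      \<Rightarrow> (('n::{finite,linorder}, 'r::finite) rmat \<Rightarrow> ('k::{finite,linorder} \<Rightarrow> 'n)
            \<Rightarrow> ('k \<times> 'k, 'k \<times> 'k) rmat)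
      \<Rightarrow> (nat \<Rightarrow> 'w \<Rightarrow> 'k \<Rightarrow> 'n)
      \<Rightarrow> (nat \<Rightarrow> 'w \<Rightarrow> ('k, 'k) rmat) \<Rightarrow> (nat \<Rightarrow> 'w \<Rightarrow> ('n, 'r) rmat) \<Rightarrow> bool" where
  "nonanticipating M \<F> Q B V X \<longleftrightarrow>
    filtration (space M) \<F> \<and>
    (\<forall>t. sets (\<F> t) \<subseteq> sets M \<and>
         B t \<in> \<F> (Suc t) \<rightarrow>\<^sub>M count_space blocks \<and>
         V t \<in> borel_measurable (\<F> (Suc t)) \<and>
         (\<forall>b\<in>blocks. (\<lambda>\<omega>. Q (X t \<omega>) b) \<in> borel_measurable (\<F> t)))"

end

theory Submission
  imports Defs
begin

text \<open>
  The descent inequality and \<open>\<parallel>U E U^T X\<parallel>_H = \<parallel>E\<parallel>_Q\<close> for the lower matrix \<open>Q\<close> show that the majorizer at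
  \<open>V\<close> exceeds the objective at the updated point by at least \<open>\<alpha>/2 \<parallel>V - I\<parallel>^2\<close>. It equals the objective at
  the old point when \<open>V = I\<close>, so a minimizer \<open>V\<close> gives the sufficient decrease of part (a), and
  telescoping bounds the sum of the \<open>\<parallel>V - I\<parallel>^2\<close> along every path. For part (b), independence of \<open>B t\<close>
  from the past makes the expected gap at \<open>X t\<close> equal to the expected squared distance from \<open>I\<close> to the
  argmin set of the block actually drawn, which is at most \<open>E \<parallel>V t - I\<parallel>^2\<close>; the least of these
  expectations is at most their average. The remaining issue is measurability of the distance to the
  argmin set. It follows from joint lower semicontinuity of the majorizer, since minima of such
  functions over compact sets are lower semicontinuous in the parameters.
\<close>

subsection \<open>The block update and sufficient decrease\<close>

lemma inner_matrix_mult_left: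
  fixes A :: "real^'n^'m" and C :: "real^'p^'n"
  shows "(A ** C) \<bullet> D = C \<bullet> (transpose A ** D)"
proof -
  have "(A ** C) \<bullet> D = (\<Sum>i\<in>UNIV. \<Sum>j\<in>UNIV. \<Sum>l\<in>UNIV. A $ i $ l * C $ l $ j * D $ i $ j)"
    by (simp add: inner_vec_def matrix_matrix_mult_def sum_distrib_right)
  also have "\<dots> = (\<Sum>i\<in>UNIV. \<Sum>l\<in>UNIV. \<Sum>j\<in>UNIV. A $ i $ l * C $ l $ j * D $ i $ j)"
    by (intro sum.cong refl sum.swap)
  also have "\<dots> = (\<Sum>l\<in>UNIV. \<Sum>i\<in>UNIV. \<Sum>j\<in>UNIV. A $ i $ l * C $ l $ j * D $ i $ j)"
    by (rule sum.swap)
  also have "\<dots> = (\<Sum>l\<in>UNIV. \<Sum>j\<in>UNIV. \<Sum>i\<in>UNIV. A $ i $ l * C $ l $ j * D $ i $ j)"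
    by (intro sum.cong refl sum.swap)
  also have "\<dots> = C \<bullet> (transpose A ** D)"
    by (simp add: inner_vec_def matrix_matrix_mult_def transpose_def sum_distrib_left mult_ac)
  finally show ?thesis .
qed

lemma inner_transpose: "transpose A \<bullet> transpose B = (A :: real^'n^'m) \<bullet> B"
  by (simp add: inner_vec_def transpose_def) (rule sum.swap)

lemma inner_matrix_mult_right:
  fixes A :: "real^'n^'m" and C :: "real^'p^'n"
  shows "(A ** C) \<bullet> D = A \<bullet> (D ** transpose C)"
proof -
  have "(A ** C) \<bullet> D = (transpose C ** transpose A) \<bullet> transpose D"
    by (metis inner_transpose matrix_transpose_mul)
  also have "\<dots> = transpose A \<bullet> transpose (D ** transpose C)"
    by (simp add: inner_matrix_mult_left matrix_transpose_mul)
  finally show ?thesis by (simp add: inner_transpose)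
qed

lemma matrix_add_rdistrib: "(B + C) ** A = B ** A + C ** (A :: real^'p^'n)"
  by (vector matrix_matrix_mult_def sum.distrib[symmetric] field_simps)

lemma matrix_diff_ldistrib: "A ** (B - C) = A ** B - A ** (C :: real^'p^'n)"
  using matrix_add_ldistrib[of A "B - C" C] by (simp add: algebra_simps)

lemma matrix_diff_rdistrib: "(B - C) ** A = B ** A - (C :: real^'p^'n) ** A"
  using matrix_add_rdistrib[of "B - C" C A] by (simp add: algebra_simps)

lemma norm_St_mult:
  fixes P :: "real^'r^'n" and A :: "real^'p^'r"
  assumes "P \<in> St"
  shows "norm (P ** A) = norm A"
proof -
  have "(P ** A) \<bullet> (P ** A) = A \<bullet> A"
    using assms by (simp add: St_def inner_matrix_mult_left matrix_mul_assoc)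
  then show ?thesis by (simp add: norm_eq_sqrt_inner)
qed

lemma norm_mult_transpose_St:
  fixes P :: "real^'r^'n" and A :: "real^'r^'p"
  assumes "P \<in> St"
  shows "norm (A ** transpose P) = norm A"
proof -
  have "(A ** transpose P) \<bullet> (A ** transpose P) = A \<bullet> A"
    using assms by (simp add: St_def inner_matrix_mult_right flip: matrix_mul_assoc)
  then show ?thesis by (simp add: norm_eq_sqrt_inner)
qed

text \<open>Moving \<open>P\<close> across the inner product and applying Cauchy-Schwarz bounds the
  square of \<open>norm (A ** P)\<close> by \<open>norm A * norm (A ** P)\<close>, because right
  multiplication by \<open>transpose P\<close> is isometric.\<close>

lemma norm_mult_St_le:
  fixes P :: "real^'r^'n" and A :: "real^'n^'p"
  assumes "P \<in> St"
  shows "norm (A ** P) \<le> norm A"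
proof -
  have "(norm (A ** P))\<^sup>2 = A \<bullet> (A ** P ** transpose P)"
    by (simp add: power2_norm_eq_inner inner_matrix_mult_right)
  also have "\<dots> \<le> norm A * norm (A ** P)"
    by (metis norm_cauchy_schwarz norm_mult_transpose_St[OF assms])
  finally show ?thesis by (cases "A ** P = 0") (auto simp: power2_eq_square)
qed

lemma mat_1_in_St: "mat 1 \<in> St"
  by (simp add: St_def)

lemma compact_St: "compact (St :: (real^'r^'n) set)"
proof (rule compact_eq_bounded_closed[THEN iffD2], safe)
  have "norm P = norm (mat 1 :: real^'r^'r)" if "P \<in> St" for P :: "real^'r^'n"
    using norm_St_mult[OF that, of "mat 1"] by simp
  then show "bounded (St :: (real^'r^'n) set)"
    by (metis boundedI order.refl)
  have "continuous_on UNIV (\<lambda>P :: real^'r^'n. transpose P ** P)"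
    unfolding matrix_matrix_mult_def transpose_def by (auto intro!: continuous_intros)
  then have "closed ((\<lambda>P :: real^'r^'n. transpose P ** P) -` {mat 1})"
    by (auto intro: continuous_closed_vimage simp: continuous_on_eq_continuous_at)
  then show "closed (St :: (real^'r^'n) set)"
    by (simp add: St_def vimage_def)
qed

section \<open>Selection matrices, vectorisation and quadratic forms\<close>

lemma U_mult_nth:
  fixes M :: "real^'p^'k" and B :: "'k::finite \<Rightarrow> 'n::finite"
  assumes "inj B"
  shows "(U B ** M) $ B i = M $ i"
  using assms by (simp add: vec_eq_iff matrix_matrix_mult_def U_def inj_eq if_distrib if_distribR cong: if_cong)

lemma U_mult_nth_notin:
  fixes M :: "real^'p^'k" and B :: "'k::finite \<Rightarrow> 'n::finite"
  assumes "j \<notin> range B"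
  shows "(U B ** M) $ j = 0"
  using assms by (auto simp: vec_eq_iff matrix_matrix_mult_def U_def intro!: sum.neutral)

lemma transpose_U_mult_nth:
  fixes M :: "real^'p^'n" and B :: "'k::finite \<Rightarrow> 'n::finite"
  shows "(transpose (U B) ** M) $ i = M $ B i"
  by (simp add: vec_eq_iff matrix_matrix_mult_def U_def transpose_def if_distrib if_distribR cong: if_cong)

lemma U_in_St:
  fixes B :: "'k::finite \<Rightarrow> 'n::finite"
  assumes "inj B"
  shows "U B \<in> St"
  using assms by (auto simp: St_def vec_eq_iff transpose_U_mult_nth) (simp add: U_def mat_def inj_eq)

lemma blocks_inj: "B \<in> blocks \<Longrightarrow> inj B"
  by (simp add: blocks_def strict_mono_imp_inj_on)

lemma vectorize_mult_kron:
  fixes A :: "real^'k^'n" and E :: "real^'l^'k" and Z :: "real^'r^'l"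
  shows "vectorize (A ** E ** Z) = kron (transpose Z) A *v vectorize E"
proof (simp add: vec_eq_iff, safe)
  fix c :: 'r and i :: 'n
  have "vectorize (A ** E ** Z) $ (c, i) = (\<Sum>l\<in>UNIV. \<Sum>j\<in>UNIV. A $ i $ j * E $ j $ l * Z $ l $ c)"
    by (simp add: vectorize_def matrix_matrix_mult_def sum_distrib_right)
  also have "\<dots> = (\<Sum>q\<in>UNIV. kron (transpose Z) A $ (c, i) $ q * vectorize E $ q)"
    unfolding UNIV_Times_UNIV[symmetric] sum.cartesian_product
    by (auto simp: kron_def vectorize_def transpose_def intro!: sum.cong)
  finally show "vectorize (A ** E ** Z) $ (c, i) = (kron (transpose Z) A *v vectorize E) $ (c, i)"
    by (simp add: matrix_vector_mult_def)
qed

lemma norm_vectorize: "norm (vectorize Y) = norm Y"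
proof -
  have "vectorize Y \<bullet> vectorize Y = (\<Sum>j\<in>UNIV. \<Sum>i\<in>UNIV. Y $ i $ j * Y $ i $ j)"
    unfolding inner_vec_def UNIV_Times_UNIV[symmetric] sum.cartesian_product
    by (auto simp: vectorize_def intro!: sum.cong)
  also have "\<dots> = Y \<bullet> Y"
    by (simp add: inner_vec_def) (rule sum.swap)
  finally show ?thesis by (simp add: norm_eq_sqrt_inner)
qed

text \<open>The matrix \<open>Q_lower H X B\<close> has the form
  \<open>transpose K ** H ** K\<close>, where \<open>K\<close> represents the linear map from
  \<open>E\<close> to \<open>U B ** E ** transpose (U B) ** X\<close> in vectorised coordinates. It
  is thus the pull-back of the form \<open>H\<close> along that map.\<close>

lemma sqnorm_wrt_Q_lower:
  "sqnorm_wrt (Q_lower H X B) E = sqnorm_wrt H (U B ** E ** transpose (U B) ** X)"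
proof -
  define K where "K = kron (transpose (transpose (U B) ** X)) (U B)"
  have "U B ** E ** transpose (U B) ** X = U B ** E ** (transpose (U B) ** X)"
    by (simp add: matrix_mul_assoc)
  then have "sqnorm_wrt H (U B ** E ** transpose (U B) ** X)
      = (K *v vectorize E) \<bullet> (H *v (K *v vectorize E))"
    by (simp only: sqnorm_wrt_def vectorize_mult_kron K_def)
  also have "\<dots> = vectorize E \<bullet> (transpose K *v (H *v (K *v vectorize E)))"
    by (metis dot_lmul_matrix inner_commute transpose_matrix_vector)
  finally show ?thesis
    by (simp add: sqnorm_wrt_def Q_lower_def Let_def matrix_vector_mul_assoc matrix_mul_assoc
        flip: K_def)
qed

lemma sqnorm_wrt_add_scaleR_mat:
  "sqnorm_wrt (A + a *\<^sub>R mat 1) Y = sqnorm_wrt A Y + a * (norm Y)\<^sup>2"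
  by (simp add: sqnorm_wrt_def matrix_vector_mult_add_rdistrib inner_right_distrib
      scaleR_matrix_vector_assoc[symmetric] norm_vectorize[symmetric] power2_norm_eq_inner)

lemma sqnorm_wrt_le_spectral_norm: "sqnorm_wrt A Y \<le> spectral_norm A * (norm Y)\<^sup>2"
proof -
  have "sqnorm_wrt A Y \<le> norm (vectorize Y) * norm (A *v vectorize Y)"
    unfolding sqnorm_wrt_def by (rule norm_cauchy_schwarz)
  also have "\<dots> \<le> norm (vectorize Y) * (spectral_norm A * norm (vectorize Y))"
    unfolding spectral_norm_def by (intro mult_left_mono onorm) auto
  finally show ?thesis by (simp add: norm_vectorize power2_eq_square mult_ac)
qed

text \<open>A scalar \<sigma> that dominates the spectral norm dominates the form itself. So either
  choice of \<open>Q\<close> keeps the quadratic model above the one given by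
  \<open>Q_lower\<close>, and the majorizer remains an upper bound.\<close>

lemma sqnorm_wrt_admissible_Q:
  assumes "admissible_Q H L Q" "X \<in> St" "B \<in> blocks"
  shows "sqnorm_wrt (Q_lower H X B) Y \<le> sqnorm_wrt (Q X B) Y"
proof -
  consider "Q X B = Q_lower H X B"
    | \<sigma> where "spectral_norm (Q_lower H X B) \<le> \<sigma>" "Q X B = \<sigma> *\<^sub>R mat 1"
    using assms unfolding admissible_Q_def by blast
  then show ?thesis
  proof cases
    case 2
    have "sqnorm_wrt (Q X B) Y = sqnorm_wrt 0 Y + \<sigma> * (norm Y)\<^sup>2"
      using sqnorm_wrt_add_scaleR_mat[of 0 \<sigma> Y] 2 by simp
    then have "sqnorm_wrt (Q X B) Y = \<sigma> * (norm Y)\<^sup>2"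
      by (simp add: sqnorm_wrt_def)
    then show ?thesis
      using sqnorm_wrt_le_spectral_norm[of "Q_lower H X B" Y] 2(1)
      by (smt (verit) mult_right_mono zero_le_power2)
  qed simp
qed

section \<open>The block update as a function of an arbitrary candidate \<open>V\<close>\<close>

definition row_update :: "('k::finite \<Rightarrow> 'n::finite) \<Rightarrow> real^'k^'k \<Rightarrow> real^'r^'n \<Rightarrow> real^'r^'n" where
  "row_update B V X = X + U B ** (V - mat 1) ** transpose (U B) ** X"

lemma row_update_nth:
  fixes B :: "'k::finite \<Rightarrow> 'n::finite"
  assumes "inj B"
  shows "row_update B V X $ B i = (V ** transpose (U B) ** X) $ i"
proof -
  have "row_update B V X $ B i = X $ B i + ((V - mat 1) ** (transpose (U B) ** X)) $ i"
    using U_mult_nth[OF assms] by (simp add: row_update_def flip: matrix_mul_assoc)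
  then show ?thesis
    by (simp add: matrix_diff_rdistrib transpose_U_mult_nth matrix_mul_assoc)
qed

lemma row_update_nth_notin:
  fixes B :: "'k::finite \<Rightarrow> 'n::finite"
  assumes "j \<notin> range B"
  shows "row_update B V X $ j = X $ j"
  using U_mult_nth_notin[OF assms] by (simp add: row_update_def flip: matrix_mul_assoc)

text \<open>The update is left multiplication by \<open>mat 1 + W\<close>, where \<open>W\<close> is
  \<open>E = V - mat 1\<close> conjugated by \<open>U B\<close>. Orthogonality of \<open>V\<close>
  says that \<open>E + transpose E + transpose E ** E\<close> vanishes. Since \<open>U B\<close> has
  orthonormal columns, the same identity holds for \<open>W\<close>, so \<open>mat 1 + W\<close> is
  orthogonal and the Gram matrix of \<open>X\<close> is preserved.\<close>

lemma row_update_in_St: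
  fixes X :: "real^'r^'n" and B :: "'k::finite \<Rightarrow> 'n::finite"
  assumes "inj B" "V \<in> St" "X \<in> St"
  shows "row_update B V X \<in> St"
proof -
  define P where "P = U B"
  define E where "E = V - mat 1"
  define W where "W = P ** E ** transpose P"
  have P: "transpose P ** P = mat 1"
    using U_in_St[OF assms(1)] by (simp add: P_def St_def)
  have PP: "A ** transpose P ** P = A" for A :: "real^'k^'n"
    by (simp add: P flip: matrix_mul_assoc)
  have tW: "transpose W = P ** transpose E ** transpose P"
    by (simp add: W_def matrix_transpose_mul matrix_mul_assoc)
  have tE: "transpose E = transpose V - mat 1"
    by (simp add: E_def transpose_def vec_eq_iff mat_def)
  have "transpose V ** V = mat 1"
    using assms(2) by (simp add: St_def)
  then have E0: "E + transpose E + transpose E ** E = 0"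
    by (simp add: tE) (simp add: E_def matrix_diff_ldistrib matrix_diff_rdistrib)
  have "transpose W ** W = P ** transpose E ** transpose P ** P ** E ** transpose P"
    by (simp add: tW) (simp add: W_def matrix_mul_assoc)
  also have "\<dots> = P ** (transpose E ** E) ** transpose P"
    using PP[of "P ** transpose E"] by (simp add: matrix_mul_assoc)
  finally have "W + transpose W + transpose W ** W = P ** (E + transpose E + transpose E ** E) ** transpose P"
    unfolding tW by (simp add: W_def matrix_add_ldistrib matrix_add_rdistrib)
  then have W0: "W + transpose W + transpose W ** W = 0"
    by (simp add: E0)
  have "row_update B V X = (mat 1 + W) ** X"
    by (simp add: row_update_def W_def P_def E_def matrix_add_rdistrib)
  moreover have "transpose (mat 1 + W) ** (mat 1 + W) = mat 1 + (W + transpose W + transpose W ** W)"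
  proof -
    have "transpose (mat 1 + W) = mat 1 + transpose W"
      by (auto simp add: transpose_def vec_eq_iff mat_def)
    then show ?thesis by (simp add: matrix_add_ldistrib matrix_add_rdistrib)
  qed
  moreover have "transpose ((mat 1 + W) ** X) ** ((mat 1 + W) ** X)
      = transpose X ** (transpose (mat 1 + W) ** (mat 1 + W)) ** X"
    by (simp only: matrix_transpose_mul matrix_mul_assoc)
  ultimately have "transpose (row_update B V X) ** row_update B V X = transpose X ** X"
    by (simp add: W0)
  then show ?thesis using assms(3) by (simp add: St_def)
qed

lemma norm_row_update_diff_le:
  fixes X :: "real^'r^'n" and B :: "'k::finite \<Rightarrow> 'n::finite"
  assumes "inj B" "X \<in> St"
  shows "norm (row_update B V X - X) \<le> norm (V - mat 1)"
proof -
  have "norm (row_update B V X - X) \<le> norm (U B ** (V - mat 1) ** transpose (U B))"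
    using norm_mult_St_le[OF assms(2)] by (simp add: row_update_def)
  also have "\<dots> = norm (V - mat 1)"
    using U_in_St[OF assms(1)] by (metis norm_St_mult norm_mult_transpose_St)
  finally show ?thesis .
qed

text \<open>Moving \<open>X\<close> and both factors \<open>U B\<close> to the other side of the
  inner product turns the linear term of the descent inequality into the linear term of the
  majorizer.\<close>

lemma inner_row_update_diff:
  "(row_update B V X - X) \<bullet> G = (V - mat 1) \<bullet> subblock B (G ** transpose X)"
proof -
  have "(row_update B V X - X) \<bullet> G = (U B ** (V - mat 1) ** transpose (U B)) \<bullet> (G ** transpose X)"
    by (simp add: row_update_def inner_matrix_mult_right[of _ X])
  also have "\<dots> = (U B ** (V - mat 1)) \<bullet> (G ** transpose X ** U B)"
    by (simp add: inner_matrix_mult_right[of _ "transpose (U B)"])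
  finally show ?thesis
    by (simp add: inner_matrix_mult_left[of "U B"] subblock_def matrix_mul_assoc)
qed

lemma sep_row_update:
  fixes X :: "real^'r^'n" and B :: "'k::finite \<Rightarrow> 'n::finite"
  assumes "inj B"
  shows "sep h (row_update B V X) = sep h (V ** transpose (U B) ** X) + sep_compl h B X"
proof -
  let ?s = "\<lambda>i. \<Sum>j\<in>UNIV. h (row_update B V X $ i $ j)"
  have "sep h (row_update B V X) = sum ?s (range B) + sum ?s (- range B)"
    unfolding sep_def by (subst sum.union_disjoint[symmetric]) auto
  also have "sum ?s (range B) = sep h (V ** transpose (U B) ** X)"
    by (simp add: sep_def sum.reindex[OF assms] row_update_nth[OF assms])
  also have "sum ?s (- range B) = sep_compl h B X"
    by (simp add: sep_compl_def row_update_nth_notin)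
  finally show ?thesis .
qed

text \<open>All finite terms are gathered into one real number, and the two sums of
  \<open>h\<close>, which may be infinite, stay separate. Inequalities and semicontinuity can then
  be handled summand by summand, without subtraction of infinite values.\<close>

lemma majorizer_eq:
  "majorizer f gradf h Q \<alpha> X B V =
    ereal (1/2 * sqnorm_wrt (Q X B + \<alpha> *\<^sub>R mat 1) (V - mat 1)
      + (V - mat 1) \<bullet> subblock B (gradf X ** transpose X) + f X)
    + sep h (V ** transpose (U B) ** X) + sep_compl h B X"
proof -
  have *: "ereal a + ereal b + s + (ereal r + s' - ereal d) = ereal (a + (b - d) + r) + s + s'"
    for a b d r s s'
    by (cases s; cases s') auto
  show ?thesis
    unfolding majorizer_def Let_def * by (simp add: inner_diff_left)
qed

lemma majorizer_mat_1:
  assumes "inj B"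
  shows "majorizer f gradf h Q \<alpha> X B (mat 1) = objective f h X"
  using sep_row_update[OF assms, of h "mat 1" X]
  by (simp add: majorizer_eq objective_def row_update_def sqnorm_wrt_def vectorize_def
      zero_vec_def[symmetric] add.assoc)

text \<open>Only rows in the range of \<open>B\<close> change, so the descent inequality applies.
  Its linear and quadratic terms are those of the majorizer with \<open>Q_lower\<close>, replacing
  \<open>Q_lower\<close> by \<open>Q\<close> can only increase the bound, and the summand \<alpha>
  times the identity supplies exactly the extra square. The additive form stays meaningful for
  infinite objective values.\<close>

lemma objective_row_update_le_majorizer:
  fixes f :: "('n::{finite,linorder}, 'r::finite) rmat \<Rightarrow> real"
    and B :: "'k::{finite,linorder} \<Rightarrow> 'n"
  assumes descent: "\<And>Y Y'. card {i. Y' $ i \<noteq> Y $ i} \<le> CARD('k) \<Longrightarrow>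
          f Y' \<le> f Y + (Y' - Y) \<bullet> gradf Y + 1/2 * sqnorm_wrt H (Y' - Y)"
    and Q: "admissible_Q H L Q" and "X \<in> St" "B \<in> blocks"
  shows "objective f h (row_update B V X) + ereal (\<alpha> / 2 * (norm (V - mat 1))\<^sup>2)
    \<le> majorizer f gradf h Q \<alpha> X B V"
proof -
  note inj = blocks_inj[OF \<open>B \<in> blocks\<close>]
  define D where "D = subblock B (gradf X ** transpose X)"
  have "{i. row_update B V X $ i \<noteq> X $ i} \<subseteq> range B"
    using row_update_nth_notin[of _ B V X] by blast
  then have "card {i. row_update B V X $ i \<noteq> X $ i} \<le> CARD('k)"
    by (meson card_image_le card_mono finite finite_imageI order.trans)
  then have "f (row_update B V X) \<le> f X + (row_update B V X - X) \<bullet> gradf X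
      + 1/2 * sqnorm_wrt H (row_update B V X - X)"
    by (rule descent)
  also have "sqnorm_wrt H (row_update B V X - X) = sqnorm_wrt (Q_lower H X B) (V - mat 1)"
    by (simp add: row_update_def sqnorm_wrt_Q_lower)
  also have "\<dots> \<le> sqnorm_wrt (Q X B) (V - mat 1)"
    by (rule sqnorm_wrt_admissible_Q[OF Q \<open>X \<in> St\<close> \<open>B \<in> blocks\<close>])
  finally have "f (row_update B V X) + \<alpha> / 2 * (norm (V - mat 1))\<^sup>2
      \<le> 1/2 * sqnorm_wrt (Q X B + \<alpha> *\<^sub>R mat 1) (V - mat 1) + (V - mat 1) \<bullet> D + f X"
    by (simp add: inner_row_update_diff sqnorm_wrt_add_scaleR_mat D_def add_divide_distrib)
  then have "ereal (f (row_update B V X) + \<alpha> / 2 * (norm (V - mat 1))\<^sup>2) + sep h (row_update B V X)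
      \<le> majorizer f gradf h Q \<alpha> X B V"
    unfolding majorizer_eq sep_row_update[OF inj] add.assoc[symmetric] D_def[symmetric]
    by (intro add_mono) auto
  then show ?thesis
    by (simp add: objective_def add_ac flip: plus_ereal.simps(1))
qed

lemma objective_row_update_argmin:
  fixes f :: "('n::{finite,linorder}, 'r::finite) rmat \<Rightarrow> real"
    and B :: "'k::{finite,linorder} \<Rightarrow> 'n"
  assumes descent: "\<And>Y Y'. card {i. Y' $ i \<noteq> Y $ i} \<le> CARD('k) \<Longrightarrow>
          f Y' \<le> f Y + (Y' - Y) \<bullet> gradf Y + 1/2 * sqnorm_wrt H (Y' - Y)"
    and Q: "admissible_Q H L Q" and "X \<in> St" "B \<in> blocks"
    and V: "V \<in> argmin_V f gradf h Q \<alpha> X B"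
  shows "objective f h (row_update B V X) + ereal (\<alpha> / 2 * (norm (V - mat 1))\<^sup>2)
    \<le> objective f h X"
proof -
  have "majorizer f gradf h Q \<alpha> X B V \<le> majorizer f gradf h Q \<alpha> X B (mat 1)"
    using V mat_1_in_St by (auto simp: argmin_V_def is_arg_min_linorder)
  then show ?thesis
    using objective_row_update_le_majorizer[OF descent Q assms(3,4)]
      majorizer_mat_1[OF blocks_inj[OF \<open>B \<in> blocks\<close>]] by (metis order.trans)
qed

subsection \<open>Lower semicontinuity and measurability of argmin distances\<close>

text \<open>The limit inferior in the definition ignores the point itself, which is why
  \<open>x\<close> is treated apart from its neighbours. The open superlevel sets are the form used
  from here on.\<close>

lemma lower_semicontinuous_iff_open:
  "lower_semicontinuous g \<longleftrightarrow> (\<forall>a. open {x. a < g x})"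
proof safe
  fix a assume g: "lower_semicontinuous g"
  show "open {x. a < g x}"
  proof (subst open_subopen, safe)
    fix x assume "a < g x"
    then have "eventually (\<lambda>z. a < g z) (at x)" and x: "a < g x"
      using g by (auto simp: lower_semicontinuous_def le_Liminf_iff)
    then obtain T where "open T" "x \<in> T" "\<forall>z\<in>T. z \<noteq> x \<longrightarrow> a < g z"
      by (auto simp: eventually_at_topological)
    then show "\<exists>T. open T \<and> x \<in> T \<and> T \<subseteq> {x. a < g x}"
      using x by (intro exI[of _ T]) auto
  qed
next
  assume "\<forall>a. open {x. a < g x}"
  then show "lower_semicontinuous g"
    unfolding lower_semicontinuous_def le_Liminf_iff eventually_at_topological by blast
qed

lemma lower_semicontinuous_compose:
  assumes "lower_semicontinuous g" "continuous_on UNIV \<phi>"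
  shows "lower_semicontinuous (\<lambda>x. g (\<phi> x))"
proof -
  have "open (\<phi> -` {x. a < g x})" for a
    using assms by (intro open_vimage) (auto simp: lower_semicontinuous_iff_open)
  then show ?thesis by (simp add: lower_semicontinuous_iff_open vimage_def)
qed

lemma lower_semicontinuous_ereal:
  assumes "continuous_on UNIV (\<phi> :: _ \<Rightarrow> real)"
  shows "lower_semicontinuous (\<lambda>x. ereal (\<phi> x))"
proof -
  have "continuous_on UNIV (\<lambda>x. ereal (\<phi> x))"
    using assms by (intro continuous_on_ereal)
  then show ?thesis
    by (auto simp: lower_semicontinuous_iff_open intro!: open_Collect_less)
qed

text \<open>A real \<open>b\<close> splits the level \<open>a\<close> between the two summands. This
  writes a superlevel set of a sum as a union of intersections of superlevel sets, hence as an open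
  set when the summands are lower semicontinuous.\<close>

lemma ereal_less_add_iff:
  fixes u v :: ereal
  assumes "u \<noteq> -\<infinity>" "v \<noteq> -\<infinity>"
  shows "a < u + v \<longleftrightarrow> (\<exists>b::real. ereal b < u \<and> a - ereal b < v)"
proof
  assume "\<exists>b::real. ereal b < u \<and> a - ereal b < v"
  then show "a < u + v"
    by (cases a; cases u; cases v) auto
next
  assume *: "a < u + v"
  show "\<exists>b::real. ereal b < u \<and> a - ereal b < v"
  proof (cases u)
    case (real u')
    show ?thesis
    proof (cases v)
      case (real v')
      show ?thesis
      proof (cases a)
        case (real a')
        \<comment> \<open>The excess \<open>u' + v' - a'\<close> is positive, and half of it is
          given to each summand.\<close>
        then show ?thesis
          using * \<open>u = ereal u'\<close> \<open>v = ereal v'\<close>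
          by (intro exI[of _ "u' - (u' + v' - a') / 2"]) (auto simp: field_simps)
      qed (use * \<open>u = ereal u'\<close> \<open>v = ereal v'\<close> in \<open>auto intro: exI[of _ "u' - 1"]\<close>)
    next
      case PInf
      then show ?thesis
        using * real by (intro exI[of _ "u' - 1"]; cases a) auto
    qed (use assms in simp)
  next
    case PInf
    show ?thesis
    proof (cases v)
      case (real v')
      show ?thesis
      proof (cases a)
        case (real a')
        then show ?thesis
          using PInf \<open>v = ereal v'\<close> by (intro exI[of _ "a' - v' + 1"]) auto
      qed (use * PInf \<open>v = ereal v'\<close> in auto)
    next
      case _: PInf
      then show ?thesis
        using * PInf by (intro exI[of _ 0]; cases a) auto
    qed (use assms in simp)
  qed (use assms in simp)
qed

lemma lower_semicontinuous_add:
  assumes "lower_semicontinuous g1" "lower_semicontinuous g2"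
    and "\<And>x. g1 x \<noteq> -\<infinity>" "\<And>x. g2 x \<noteq> -\<infinity>"
  shows "lower_semicontinuous (\<lambda>x. g1 x + g2 x)"
proof -
  have "{x. a < g1 x + g2 x} = (\<Union>b::real. {x. ereal b < g1 x} \<inter> {x. a - ereal b < g2 x})" for a
    using ereal_less_add_iff[OF assms(3,4)] by auto
  then show ?thesis
    using assms(1,2) by (simp add: lower_semicontinuous_iff_open open_UN open_Int)
qed

text \<open>In extended real addition \<infinity> absorbs -\<infinity>, hence the second
  conjunct.\<close>

lemma sum_eq_MInfty:
  fixes g :: "'i \<Rightarrow> ereal"
  assumes "finite I"
  shows "sum g I = -\<infinity> \<longleftrightarrow> (\<exists>i\<in>I. g i = -\<infinity>) \<and> (\<forall>i\<in>I. g i \<noteq> \<infinity>)"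
  using assms by (induction I rule: finite_induct) (auto simp: sum_Pinfty)

lemma lower_semicontinuous_sum:
  fixes g :: "'i \<Rightarrow> 'a::topological_space \<Rightarrow> ereal"
  assumes "finite I" and "\<And>i. i \<in> I \<Longrightarrow> lower_semicontinuous (g i)"
    and "\<And>i x. i \<in> I \<Longrightarrow> g i x \<noteq> -\<infinity>"
  shows "lower_semicontinuous (\<lambda>x. \<Sum>i\<in>I. g i x)"
  using assms
proof (induction I rule: finite_induct)
  case empty
  then show ?case by (simp add: lower_semicontinuous_iff_open)
next
  case (insert i I)
  then show ?case
    by (simp, intro lower_semicontinuous_add) (auto simp: sum_eq_MInfty)
qed

text \<open>Without a minimizer, the open sets where \<open>g\<close> exceeds one of its values on
  \<open>C\<close> cover \<open>C\<close>. In a finite subcover, the index with the least value of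
  \<open>g\<close> is itself a point of \<open>C\<close> that no member contains.\<close>

lemma lower_semicontinuous_attains_min:
  fixes g :: "'a::topological_space \<Rightarrow> ereal"
  assumes "compact C" "C \<noteq> {}" "lower_semicontinuous g"
  obtains x where "x \<in> C" "\<And>y. y \<in> C \<Longrightarrow> g x \<le> g y"
proof (rule ccontr)
  assume "\<not> thesis"
  then have cover: "C \<subseteq> (\<Union>y\<in>C. {z. g y < g z})"
    using that by (force simp: not_le)
  have opn: "open {z. g y < g z}" for y
    using assms(3) by (simp add: lower_semicontinuous_iff_open)
  obtain D where D: "D \<subseteq> C" "finite D" "C \<subseteq> (\<Union>y\<in>D. {z. g y < g z})"
    by (rule compactE_image[OF assms(1) opn cover])
  then have "D \<noteq> {}" using assms(2) by auto
  then obtain y where "y \<in> D" "\<And>z. z \<in> D \<Longrightarrow> g y \<le> g z"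
    using D(2) by (metis arg_min_if_finite(1) arg_min_least)
  then show False using D by (force simp: not_le[symmetric])
qed

text \<open>The complement of a superlevel set of the infimum is the projection of a closed sublevel
  set of \<open>G\<close> along the compact set \<open>C\<close>, and such projections are
  closed.\<close>

lemma lower_semicontinuous_INF_compact:
  fixes G :: "'a::euclidean_space \<times> 'b::euclidean_space \<Rightarrow> ereal"
  assumes "compact C" "lower_semicontinuous G"
  shows "lower_semicontinuous (\<lambda>x. INF v\<in>C. G (v, x))"
proof (cases "C = {}")
  case True
  then show ?thesis by (simp add: lower_semicontinuous_iff_open)
next
  case False
  show ?thesis unfolding lower_semicontinuous_iff_open
  proof
    fix a
    have "closed {p. G p \<le> a}"
      using assms(2) by (simp add: lower_semicontinuous_iff_open closed_def Collect_neg_eq[symmetric] not_le)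
    then have "closed {x. \<exists>v. v \<in> C \<and> (v, x) \<in> {p. G p \<le> a}}"
      by (rule closed_compact_projection[OF assms(1)])
    \<comment> \<open>Attainment of the infimum matters here: otherwise it could equal
      \<open>a\<close> although every value of \<open>G\<close> over \<open>C\<close> lies above
      \<open>a\<close>.\<close>
    moreover have "{x. a < (INF v\<in>C. G (v, x))} = - {x. \<exists>v. v \<in> C \<and> (v, x) \<in> {p. G p \<le> a}}"
    proof (intro set_eqI)
      fix x
      have "lower_semicontinuous (\<lambda>v. G (v, x))"
        by (intro lower_semicontinuous_compose[OF assms(2)] continuous_intros)
      then obtain v where "v \<in> C" "\<And>w. w \<in> C \<Longrightarrow> G (v, x) \<le> G (w, x)"
        using lower_semicontinuous_attains_min[OF assms(1) False] by blast
      then have "(INF v\<in>C. G (v, x)) = G (v, x)" "v \<in> C"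
        by (auto intro!: antisym INF_lower INF_greatest)
      then show "x \<in> {x. a < (INF v\<in>C. G (v, x))} \<longleftrightarrow> x \<in> - {x. \<exists>v. v \<in> C \<and> (v, x) \<in> {p. G p \<le> a}}"
        using INF_lower[of _ C "\<lambda>v. G (v, x)"] by (auto simp: not_le) (meson leD order.strict_trans2)
    qed
    ultimately show "open {x. a < (INF v\<in>C. G (v, x))}"
      by (simp only: open_Compl)
  qed
qed

lemma borel_measurable_lower_semicontinuous:
  "lower_semicontinuous g \<Longrightarrow> g \<in> borel_measurable borel"
  by (rule borel_measurableI_greater) (simp add: lower_semicontinuous_iff_open)

text \<open>
  The argmin set meets the closed ball of radius \<open>r\<close> iff the minimum over that ball is no larger
  than the global one, and both minima are lower semicontinuous in the parameter.
\<close>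

lemma borel_measurable_infdist_arg_min:
  fixes G :: "'a::euclidean_space \<times> 'b::euclidean_space \<Rightarrow> ereal"
  assumes "compact C" "C \<noteq> {}" "lower_semicontinuous G"
  shows "(\<lambda>x. infdist p {v. is_arg_min (\<lambda>v. G (v, x)) (\<lambda>v. v \<in> C) v}) \<in> borel_measurable borel"
proof -
  define A where "A x = {v. is_arg_min (\<lambda>v. G (v, x)) (\<lambda>v. v \<in> C) v}" for x
  define m where "m D x = (INF v\<in>D. G (v, x))" for D x
  have A: "A x = {v \<in> C. \<forall>w\<in>C. G (v, x) \<le> G (w, x)}" for x
    by (auto simp: A_def is_arg_min_linorder)
  have lsc: "lower_semicontinuous (\<lambda>v. G (v, x))" for x
    by (intro lower_semicontinuous_compose[OF assms(3)] continuous_intros)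
  have "A x = C \<inter> (\<Inter>w\<in>C. - {v. G (w, x) < G (v, x)})" for x
    by (auto simp: A not_less)
  then have closed: "closed (A x)" for x
    using compact_imp_closed[OF assms(1)] lsc
    by (auto intro!: closed_Int closed_INT simp: lower_semicontinuous_iff_open closed_Compl)
  have nonempty: "A x \<noteq> {}" for x
    by (rule lower_semicontinuous_attains_min[OF assms(1,2) lsc[of x]]) (auto simp: A)
  have meas: "m D \<in> borel_measurable borel" if "compact D" for D
    unfolding m_def
    by (intro borel_measurable_lower_semicontinuous lower_semicontinuous_INF_compact that assms)
  \<comment> \<open>The nonemptiness conjunct cannot be dropped: the infimum over the empty set is
    \<infinity>, and \<open>m C x\<close> may be \<infinity> as well.\<close>
  have iff: "infdist p (A x) \<le> r \<longleftrightarrow> C \<inter> cball p r \<noteq> {} \<and> m (C \<inter> cball p r) x \<le> m C x" for x r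
  proof
    assume r: "infdist p (A x) \<le> r"
    obtain v where v: "v \<in> A x" "infdist p (A x) = dist p v"
      using infdist_attains_inf[OF closed nonempty] by blast
    then have vD: "v \<in> C \<inter> cball p r" using r by (auto simp: A)
    then have "m (C \<inter> cball p r) x \<le> G (v, x)"
      unfolding m_def by (rule INF_lower)
    also have "\<dots> \<le> m C x"
      using v(1) unfolding m_def A by (auto intro: INF_greatest)
    finally show "C \<inter> cball p r \<noteq> {} \<and> m (C \<inter> cball p r) x \<le> m C x"
      using vD by blast
  next
    assume "C \<inter> cball p r \<noteq> {} \<and> m (C \<inter> cball p r) x \<le> m C x"
    then obtain w where w: "w \<in> C" "w \<in> cball p r" and le: "m (C \<inter> cball p r) x \<le> m C x"
      by blast
    \<comment> \<open>A minimizer over the part of \<open>C\<close> in the ball; the assumed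
      comparison of minima makes it a minimizer over all of \<open>C\<close>.\<close>
    obtain v where v: "v \<in> C \<inter> cball p r" "\<And>w. w \<in> C \<inter> cball p r \<Longrightarrow> G (v, x) \<le> G (w, x)"
      using lower_semicontinuous_attains_min[of "C \<inter> cball p r", OF _ _ lsc] assms(1) w
      by (metis IntI compact_Int compact_cball empty_iff)
    have "G (v, x) \<le> m (C \<inter> cball p r) x"
      unfolding m_def by (intro INF_greatest v)
    also note le
    finally have "G (v, x) \<le> G (w, x)" if "w \<in> C" for w
      using that unfolding m_def by (meson INF_lower order.trans)
    then have "v \<in> A x" using v(1) by (simp add: A)
    then show "infdist p (A x) \<le> r" using v(1) by (auto intro: infdist_le2)
  qed
  have "{x. infdist p (A x) \<le> r} \<in> sets borel" for r
  proof (cases "C \<inter> cball p r = {}")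
    case False
    have [measurable]: "m (C \<inter> cball p r) \<in> borel_measurable borel" "m C \<in> borel_measurable borel"
      using assms(1) by (auto intro!: meas compact_Int)
    show ?thesis unfolding iff using False by measurable
  qed (simp add: iff)
  then show ?thesis
    unfolding A_def[symmetric] by (simp add: borel_measurable_iff_le)
qed

text \<open>The gradient may be discontinuous, but each component is a pointwise limit of difference
  quotients of the continuous function \<open>f\<close> with steps 1/(n+1).\<close>

lemma borel_measurable_GDERIV:
  fixes f :: "'a::euclidean_space \<Rightarrow> real"
  assumes "\<And>x. GDERIV f x :> g x"
  shows "g \<in> borel_measurable borel"
proof (subst borel_measurable_euclidean_space, safe)
  fix b :: 'a assume "b \<in> Basis"
  have der: "(f has_derivative (\<lambda>h. h \<bullet> g x)) (at x)" for x
    using assms by (simp add: gderiv_def)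
  have "continuous_on UNIV f"
    using der by (meson continuous_at_imp_continuous_on has_derivative_continuous)
  then have [measurable]: "f \<in> borel_measurable borel"
    by (rule borel_measurable_continuous_onI)
  have lim: "(\<lambda>n. (f (x + inverse (real (Suc n)) *\<^sub>R b) - f x) / inverse (real (Suc n))) \<longlonglongrightarrow> g x \<bullet> b" for x
  proof -
    have "((\<lambda>t. f (x + t *\<^sub>R b)) has_derivative (\<lambda>t. (t *\<^sub>R b) \<bullet> g x)) (at 0)"
      by (rule has_derivative_compose[of "\<lambda>t. x + t *\<^sub>R b" "\<lambda>t. t *\<^sub>R b" _ _ f])
        (auto intro!: derivative_eq_intros der)
    moreover have "(\<lambda>t. (t *\<^sub>R b) \<bullet> g x) = (*) (g x \<bullet> b)"
      by (auto simp: inner_commute)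
    ultimately have "((\<lambda>t. f (x + t *\<^sub>R b)) has_field_derivative (g x \<bullet> b)) (at 0)"
      by (simp add: has_field_derivative_def)
    then have "((\<lambda>h. (f (x + h *\<^sub>R b) - f x) / h) \<longlongrightarrow> g x \<bullet> b) (at 0)"
      by (simp add: DERIV_def)
    moreover have "filterlim (\<lambda>n. inverse (real (Suc n))) (at 0) sequentially"
      using LIMSEQ_inverse_real_of_nat by (auto simp: filterlim_at)
    ultimately show ?thesis by (rule filterlim_compose)
  qed
  show "(\<lambda>x. g x \<bullet> b) \<in> borel_measurable borel"
    by (rule borel_measurable_LIMSEQ_real[OF lim]) measurable
qed

text \<open>Split \<open>\<phi> (B \<omega>) \<omega>\<close> as the sum over \<open>b\<close> of
  the indicator of \<open>B \<omega> = b\<close> times \<open>\<phi> b \<omega>\<close>. The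
  indicator depends on \<open>B\<close> alone and \<open>\<phi> b\<close> is measurable for
  \<open>N\<close>, so each expectation factors, and the indicator has mean
  \<open>1 / card I\<close>.\<close>

lemma (in prob_space) uniform_indep_expectation:
  fixes \<phi> :: "'i \<Rightarrow> 'a \<Rightarrow> real"
  assumes I: "finite I" and B: "B \<in> M \<rightarrow>\<^sub>M count_space I"
    and unif: "distr M (count_space I) B = uniform_count_measure I"
    and indep: "indep_set (sets (vimage_algebra (space M) B (count_space I))) (sets N)"
    and N: "space N = space M"
    and \<phi>: "\<And>b. b \<in> I \<Longrightarrow> \<phi> b \<in> borel_measurable N"
    and bound: "\<And>b \<omega>. b \<in> I \<Longrightarrow> \<omega> \<in> space M \<Longrightarrow> norm (\<phi> b \<omega>) \<le> K"
  shows "integrable M (\<lambda>\<omega>. \<phi> (B \<omega>) \<omega>)"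
    and "expectation (\<lambda>\<omega>. \<phi> (B \<omega>) \<omega>) = (\<Sum>b\<in>I. expectation (\<phi> b)) / card I"
    and "b \<in> I \<Longrightarrow> integrable M (\<phi> b)"
proof -
  define X where "X b \<omega> = (if B \<omega> = b then 1 else 0 :: real)" for b \<omega>
  have NM: "sets N \<subseteq> sets M"
    using indep_setD_ev2[OF indep] .
  have \<phi>M: "\<phi> b \<in> borel_measurable M" if "b \<in> I" for b
    using \<phi>[OF that] NM N by (intro measurable_from_subalg[of M N]) (auto simp: subalgebra_def)
  show int_\<phi>: "integrable M (\<phi> b)" if "b \<in> I" for b
    by (rule integrable_const_bound[of _ K]) (use \<phi>M[OF that] bound[OF that] in auto)
  have X_meas: "X b \<in> borel_measurable (vimage_algebra (space M) B (count_space I))" if "b \<in> I" for b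
  proof -
    have "B \<in> vimage_algebra (space M) B (count_space I) \<rightarrow>\<^sub>M count_space I"
      using B by (intro measurable_vimage_algebra1) (auto simp: measurable_def)
    then have "(\<lambda>\<omega>. (\<lambda>i. if i = b then 1 else 0 :: real) (B \<omega>))
        \<in> borel_measurable (vimage_algebra (space M) B (count_space I))"
      by (rule measurable_compose) simp
    then show ?thesis by (simp add: X_def[abs_def])
  qed
  have X_M: "X b \<in> borel_measurable M" if "b \<in> I" for b
    using measurable_compose[OF B, of "\<lambda>i. if i = b then 1 else 0 :: real" borel]
    by (simp add: X_def[abs_def])
  have int_X: "integrable M (X b)" if "b \<in> I" for b
    by (rule integrable_const_bound[of _ 1]) (use X_M[OF that] in \<open>auto simp: X_def\<close>)
  have EX: "expectation (X b) = 1 / card I" if "b \<in> I" for b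
  proof -
    have "expectation (X b) = (\<integral>i. (if i = b then 1 else 0 :: real) \<partial>distr M (count_space I) B)"
      by (subst integral_distr[OF B]) (auto simp: X_def[abs_def])
    also have "\<dots> = 1 / card I"
      using I that by (simp add: unif integral_uniform_count_measure)
    finally show ?thesis .
  qed
  have indep_X: "indep_var borel (X b) borel (\<phi> b)" if "b \<in> I" for b
    unfolding indep_var_eq
  proof (intro conjI)
    \<comment> \<open>The sigma-algebras generated by the two variables lie inside the two
      independent ones, and independence passes to smaller families.\<close>
    let ?A = "{X b -` A \<inter> space M |A. A \<in> sets borel}" and ?C = "{\<phi> b -` A \<inter> space M |A. A \<in> sets borel}"
    have "?A \<subseteq> sets (vimage_algebra (space M) B (count_space I))"
      using measurable_sets[OF X_meas[OF that]] by auto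
    then have 1: "sigma_sets (space M) ?A \<subseteq> sets (vimage_algebra (space M) B (count_space I))"
      using sets.sigma_sets_subset[of ?A "vimage_algebra (space M) B (count_space I)"] by simp
    have "?C \<subseteq> sets N"
      using measurable_sets[OF \<phi>[OF that]] N by auto
    then have 2: "sigma_sets (space M) ?C \<subseteq> sets N"
      using sets.sigma_sets_subset[of ?C N] N by simp
    show "indep_set (sigma_sets (space M) ?A) (sigma_sets (space M) ?C)"
      using indep unfolding indep_set_def
      by (rule indep_sets_mono_sets) (use 1 2 in \<open>auto split: bool.split\<close>)
  qed (use X_M \<phi>M that in auto)
  have E: "\<phi> (B \<omega>) \<omega> = (\<Sum>b\<in>I. X b \<omega> * \<phi> b \<omega>)" if "\<omega> \<in> space M" for \<omega>
  proof -
    have "B \<omega> \<in> I" using measurable_space[OF B that] by simp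
    then have "(\<Sum>b\<in>I. if B \<omega> = b then \<phi> b \<omega> else 0) = \<phi> (B \<omega>) \<omega>"
      using I by simp
    then show ?thesis by (simp add: X_def if_distrib[of "\<lambda>x. x * _"] cong: if_cong)
  qed
  have int: "integrable M (\<lambda>\<omega>. X b \<omega> * \<phi> b \<omega>)" if "b \<in> I" for b
    by (intro indep_var_integrable indep_X int_X int_\<phi> that)
  then have "integrable M (\<lambda>\<omega>. \<Sum>b\<in>I. X b \<omega> * \<phi> b \<omega>)" by simp
  then show "integrable M (\<lambda>\<omega>. \<phi> (B \<omega>) \<omega>)"
    using E by (simp cong: Bochner_Integration.integrable_cong)
  have "expectation (\<lambda>\<omega>. \<phi> (B \<omega>) \<omega>) = expectation (\<lambda>\<omega>. \<Sum>b\<in>I. X b \<omega> * \<phi> b \<omega>)"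
    using E by (simp cong: Bochner_Integration.integral_cong)
  also have "\<dots> = (\<Sum>b\<in>I. expectation (X b) * expectation (\<phi> b))"
    using int by (simp add: indep_var_lebesgue_integral indep_X int_X int_\<phi>)
  finally show "expectation (\<lambda>\<omega>. \<phi> (B \<omega>) \<omega>) = (\<Sum>b\<in>I. expectation (\<phi> b)) / card I"
    by (simp add: EX sum_divide_distrib)
qed

subsection \<open>Convergence in expectation\<close>

text \<open>The entry at \<open>j\<close> of an increasing vector has exactly
  \<open>card {..<j}\<close> smaller elements in the range, so its rank in the range determines its
  position.\<close>

lemma strict_mono_range_inject:
  fixes B B' :: "'k::{finite,linorder} \<Rightarrow> 'n::linorder"
  assumes "strict_mono B" "strict_mono B'" "range B = range B'"
  shows "B = B'"
proof
  fix i
  have rank: "card {a \<in> range C. a < C j} = card {..<j}" if "strict_mono C" for C :: "'k \<Rightarrow> 'n" and j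
  proof -
    have "{a \<in> range C. a < C j} = C ` {..<j}"
      using strict_mono_less[OF that] by auto
    then show ?thesis
      using that by (simp add: card_image strict_mono_imp_inj_on)
  qed
  obtain j where j: "B i = B' j"
    using assms(3) by (metis rangeE rangeI)
  then have "card {..<i} = card {..<j}"
    using rank[OF assms(1), of i] rank[OF assms(2), of j] assms(3) by simp
  then have "\<not> {..<i} \<subset> {..<j}" "\<not> {..<j} \<subset> {..<i}"
    using psubset_card_mono[of "{..<j}" "{..<i}"] psubset_card_mono[of "{..<i}" "{..<j}"] by auto
  then have "i = j"
    by (metis lessThan_strict_subset_iff linorder_neqE)
  then show "B i = B' i" using j by simp
qed

text \<open>Taking ranges embeds the blocks into the subsets of size k. An inequality suffices: the
  gap divides a nonnegative sum by the binomial coefficient, which gives at most the average over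
  the blocks.\<close>

lemma card_blocks_le:
  "card (blocks :: ('k::{finite,linorder} \<Rightarrow> 'n::{finite,linorder}) set) \<le> CARD('n) choose CARD('k)"
proof -
  have "card (blocks :: ('k \<Rightarrow> 'n) set) = card (range ` (blocks :: ('k \<Rightarrow> 'n) set))"
    by (intro card_image[symmetric] inj_onI) (auto simp: blocks_def intro: strict_mono_range_inject)
  also have "\<dots> \<le> card {A :: 'n set. A \<subseteq> UNIV \<and> card A = CARD('k)}"
    by (intro card_mono) (auto simp: card_image blocks_inj)
  finally show ?thesis
    by (simp only: n_subsets finite)
qed

section \<open>Regularity of \<open>h\<close>, of the majorizer and of its argmin distance\<close>

lemma proper_sep_imp_neq_MInfty:
  assumes "proper (sep h :: real^'r^'n \<Rightarrow> ereal)"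
  shows "h y \<noteq> -\<infinity>"
proof
  assume "h y = -\<infinity>"
  then have "sep h (\<chi> i j. y :: real^'r^'n) = -\<infinity>"
    by (simp add: sep_def sum_eq_MInfty sum_Pinfty)
  then show False using assms by (auto simp: proper_def)
qed

text \<open>On constant matrices \<open>sep h\<close> is a positive multiple of \<open>h\<close>,
  and restriction to them is a continuous substitution. Levels of \<open>h\<close> are scaled by the
  same multiple, written as a double sum.\<close>

lemma lower_semicontinuous_sep_imp:
  assumes "proper (sep h :: real^'r^'n \<Rightarrow> ereal)" "lower_semicontinuous (sep h :: real^'r^'n \<Rightarrow> ereal)"
  shows "lower_semicontinuous h"
  unfolding lower_semicontinuous_iff_open
proof
  fix a
  have "continuous_on UNIV (\<lambda>y::real. (\<chi> i j. y) :: real^'r^'n)"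
    by (intro continuous_intros)
  then have "lower_semicontinuous (\<lambda>y. sep h ((\<chi> i j. y) :: real^'r^'n))"
    using assms(2) by (rule lower_semicontinuous_compose[rotated])
  then have *: "open {y. (\<Sum>i\<in>(UNIV::'n set). \<Sum>j\<in>(UNIV::'r set). a) < (\<Sum>i\<in>(UNIV::'n set). \<Sum>j\<in>(UNIV::'r set). h y)}"
    by (simp add: lower_semicontinuous_iff_open sep_def)
  show "open {y. a < h y}"
  proof (cases a)
    case (real a')
    have infinite: "(\<Sum>i\<in>(UNIV::'n set). \<Sum>j\<in>(UNIV::'r set). \<infinity>::ereal) = \<infinity>"
      by (simp add: sum_Pinfty)
    have "a < h y \<longleftrightarrow> (\<Sum>i\<in>(UNIV::'n set). \<Sum>j\<in>(UNIV::'r set). a) < (\<Sum>i\<in>(UNIV::'n set). \<Sum>j\<in>(UNIV::'r set). h y)" for y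
    proof
      assume "a < h y"
      then show "(\<Sum>i\<in>(UNIV::'n set). \<Sum>j\<in>(UNIV::'r set). a) < (\<Sum>i\<in>(UNIV::'n set). \<Sum>j\<in>(UNIV::'r set). h y)"
        using infinite by (cases "h y") (auto simp: real)
    next
      assume "(\<Sum>i\<in>(UNIV::'n set). \<Sum>j\<in>(UNIV::'r set). a) < (\<Sum>i\<in>(UNIV::'n set). \<Sum>j\<in>(UNIV::'r set). h y)"
      then show "a < h y"
        by (meson leD not_le_imp_less sum_mono)
    qed
    then show ?thesis using * by simp
  next
    case MInf
    then have "{y. a < h y} = UNIV"
      by (simp add: proper_sep_imp_neq_MInfty[OF assms(1)])
    then show ?thesis by simp
  qed simp
qed

lemma sep_neq_MInfty: "(\<And>y. h y \<noteq> -\<infinity>) \<Longrightarrow> sep h Y \<noteq> -\<infinity>"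
  by (simp add: sep_def sum_eq_MInfty)

lemma continuous_on_matrix_matrix_mult [continuous_intros]:
  fixes A :: "'a::topological_space \<Rightarrow> real^'n^'m" and C :: "'a \<Rightarrow> real^'p^'n"
  assumes "continuous_on S A" "continuous_on S C"
  shows "continuous_on S (\<lambda>x. A x ** C x)"
  unfolding matrix_matrix_mult_def by (intro continuous_intros assms)

lemma continuous_on_transpose [continuous_intros]:
  fixes A :: "'a::topological_space \<Rightarrow> real^'n^'m"
  assumes "continuous_on S A"
  shows "continuous_on S (\<lambda>x. transpose (A x))"
  unfolding transpose_def by (intro continuous_intros assms)

lemma continuous_on_sqnorm_wrt [continuous_intros]:
  fixes A :: "'a::topological_space \<Rightarrow> real^('c::finite \<times> 'r::finite)^('c \<times> 'r)" and Y :: "'a \<Rightarrow> real^'c^'r"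
  assumes "continuous_on S A" "continuous_on S Y"
  shows "continuous_on S (\<lambda>x. sqnorm_wrt (A x) (Y x))"
  unfolding sqnorm_wrt_def vectorize_def matrix_vector_mult_def by (intro continuous_intros assms)

text \<open>
  The gradient and \<open>Q\<close> need not be continuous in \<open>X\<close>, so they enter the majorizer as separate
  variables: it is jointly lower semicontinuous in \<open>(V, Q, D, X)\<close>.
\<close>

lemma lower_semicontinuous_majorizer:
  fixes f :: "real^'r^'n \<Rightarrow> real" and B :: "'k::finite \<Rightarrow> 'n::finite"
  assumes "lower_semicontinuous h" "\<And>y. h y \<noteq> -\<infinity>" "continuous_on UNIV f"
  shows "lower_semicontinuous
    (\<lambda>p :: (real^'k^'k) \<times> (real^('k \<times> 'k)^('k \<times> 'k)) \<times> (real^'k^'k) \<times> (real^'r^'n).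
      ereal (1/2 * sqnorm_wrt (fst (snd p) + \<alpha> *\<^sub>R mat 1) (fst p - mat 1)
        + (fst p - mat 1) \<bullet> fst (snd (snd p)) + f (snd (snd (snd p))))
      + sep h (fst p ** transpose (U B) ** snd (snd (snd p))) + sep_compl h B (snd (snd (snd p))))"
proof -
  have "continuous_on UNIV (\<lambda>p :: (real^'k^'k) \<times> (real^('k \<times> 'k)^('k \<times> 'k)) \<times> (real^'k^'k) \<times> (real^'r^'n).
      f (snd (snd (snd p))))"
    by (rule continuous_on_compose2[OF assms(3)]) (auto intro!: continuous_intros)
  then show ?thesis
    unfolding sep_def sep_compl_def
    by (intro lower_semicontinuous_add lower_semicontinuous_ereal lower_semicontinuous_sum
        lower_semicontinuous_compose[OF assms(1)] continuous_intros)
      (auto simp: sum_eq_MInfty assms(2))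
qed

lemma borel_measurable_infdist_argmin_V:
  fixes f :: "real^'r^'n \<Rightarrow> real" and B :: "'k::finite \<Rightarrow> 'n::finite"
  assumes h: "lower_semicontinuous h" "\<And>y. h y \<noteq> -\<infinity>"
    and grad: "\<And>Y. GDERIV f Y :> gradf Y"
    and X: "X \<in> borel_measurable N" and Q: "(\<lambda>\<omega>. Q (X \<omega>) B) \<in> borel_measurable N"
  shows "(\<lambda>\<omega>. infdist P (argmin_V f gradf h Q \<alpha> (X \<omega>) B)) \<in> borel_measurable N"
proof -
  have "continuous_on UNIV f"
    using grad unfolding gderiv_def
    by (meson continuous_at_imp_continuous_on has_derivative_continuous)
  note lsc = lower_semicontinuous_majorizer[OF h this, of \<alpha> B]
  define \<theta> where "\<theta> \<omega> = (Q (X \<omega>) B, subblock B (gradf (X \<omega>) ** transpose (X \<omega>)), X \<omega>)" for \<omega>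
  have "continuous_on UNIV (\<lambda>p :: (real^'r^'n) \<times> (real^'r^'n). subblock B (fst p ** transpose (snd p)))"
    unfolding subblock_def by (intro continuous_intros)
  from measurable_compose[OF _ borel_measurable_continuous_onI[OF this],
      OF borel_measurable_Pair[OF measurable_compose[OF X borel_measurable_GDERIV[OF grad]] X]]
  have "(\<lambda>\<omega>. subblock B (gradf (X \<omega>) ** transpose (X \<omega>))) \<in> borel_measurable N"
    by simp
  then have "\<theta> \<in> borel_measurable N"
    unfolding \<theta>_def by (intro borel_measurable_Pair X Q)
  moreover have "(St :: (real^'k^'k) set) \<noteq> {}"
    using mat_1_in_St by blast
  ultimately show ?thesis
    using measurable_compose[OF _ borel_measurable_infdist_arg_min[OF compact_St _ lsc, of P], of \<theta> N]
    by (simp add: argmin_V_def majorizer_eq[abs_def] \<theta>_def)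
qed

section \<open>Decrease along the run and the expected gap\<close>

theorem theorem4p2:
  fixes f :: "('n::{finite,linorder}, 'r::finite) rmat \<Rightarrow> real"
    and gradf :: "('n, 'r) rmat \<Rightarrow> ('n, 'r) rmat"
    and h :: "real \<Rightarrow> ereal"
    and H :: "('r \<times> 'n, 'r \<times> 'n) rmat"
    and Q :: "('n, 'r) rmat \<Rightarrow> ('k::{finite,linorder} \<Rightarrow> 'n) \<Rightarrow> ('k \<times> 'k, 'k \<times> 'k) rmat"
    and L\<^sub>f \<alpha> :: real
    and F :: "('n, 'r) rmat \<Rightarrow> ereal"
    and Finf c :: ereal
    and X0 :: "('n, 'r) rmat"
    and M :: "'w measure"
    and B :: "nat \<Rightarrow> 'w \<Rightarrow> 'k \<Rightarrow> 'n"
    and V :: "nat \<Rightarrow> 'w \<Rightarrow> ('k, 'k) rmat"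
    and X :: "nat \<Rightarrow> 'w \<Rightarrow> ('n, 'r) rmat"
  assumes "CARD('n) \<ge> CARD('r)" and "CARD('n) \<ge> 2" and "CARD('k) \<ge> 2"
    and grad: "\<And>Y. GDERIV f Y :> gradf Y"
    and L_pos: "L\<^sub>f > 0" and H_le: "spectral_norm H \<le> L\<^sub>f"
    and descent: "\<And>Y Y'. card {i. Y' $ i \<noteq> Y $ i} \<le> CARD('k) \<Longrightarrow>
          f Y' \<le> f Y + (Y' - Y) \<bullet> gradf Y + 1/2 * sqnorm_wrt H (Y' - Y)"
    and h_proper: "proper (sep h :: ('n, 'r) rmat \<Rightarrow> ereal)"
    and h_lsc: "lower_semicontinuous (sep h :: ('n, 'r) rmat \<Rightarrow> ereal)"
    and Q_adm: "admissible_Q H L\<^sub>f Q"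
    and \<alpha>_pos: "\<alpha> > 0"
    and solvable: "\<And>Y b. Y \<in> St \<Longrightarrow> b \<in> blocks \<Longrightarrow> argmin_V f gradf h Q \<alpha> Y b \<noteq> {}"
    and F_def: "F = objective f h"
    and Finf_def: "Finf = (INF Y\<in>St. F Y)" and Finf_gt: "Finf > -\<infinity>"
    and X0: "X0 \<in> St"
    and c_def: "c = ereal (2 / \<alpha>) * (F X0 - Finf)"
    and run: "\<And>\<omega>. \<omega> \<in> space M \<Longrightarrow>
          obcd_run f gradf h Q \<alpha> X0 (\<lambda>t. B t \<omega>) (\<lambda>t. V t \<omega>) (\<lambda>t. X t \<omega>)"
  shows "c \<ge> 0 \<and>
    (\<forall>\<omega>\<in>space M. \<forall>t.
       \<alpha> / 2 * (norm (X (Suc t) \<omega> - X t \<omega>))\<^sup>2 \<le> \<alpha> / 2 * (norm (V t \<omega> - mat 1))\<^sup>2 \<and>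
       ereal (\<alpha> / 2 * (norm (V t \<omega> - mat 1))\<^sup>2) \<le> F (X t \<omega>) - F (X (Suc t) \<omega>)) \<and>
    (\<forall>\<F>. prob_space M \<longrightarrow> nonanticipating M \<F> Q B V X \<longrightarrow> uniform_selection M \<F> B \<longrightarrow>
       (\<forall>\<epsilon>>0. \<forall>T::nat. ereal (real T) \<ge> c / ereal \<epsilon> \<longrightarrow>
          (\<exists>t\<le>T. integrable M (\<lambda>\<omega>. BS_gap f gradf h Q \<alpha> (X t \<omega>)) \<and>
                 (\<integral>\<omega>. BS_gap f gradf h Q \<alpha> (X t \<omega>) \<partial>M) \<le> \<epsilon>)))"
proof -
  have h_MInf: "h y \<noteq> -\<infinity>" for y
    by (rule proper_sep_imp_neq_MInfty[OF h_proper])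
  have h_lsc': "lower_semicontinuous h"
    by (rule lower_semicontinuous_sep_imp[OF h_proper h_lsc])
  have F_MInf: "F Y \<noteq> -\<infinity>" for Y
    using sep_neq_MInfty[of h Y, OF h_MInf] by (cases "sep h Y") (auto simp: F_def objective_def)
  have Finf_le: "Finf \<le> F Y" if "Y \<in> St" for Y
    unfolding Finf_def using that by (rule INF_lower)
  define \<phi> where "\<phi> t b \<omega> = (infdist (mat 1) (argmin_V f gradf h Q \<alpha> (X t \<omega>) b))\<^sup>2" for t b \<omega>
  define d where "d t \<omega> = (norm (V t \<omega> - mat 1))\<^sup>2" for t \<omega>
  have X_0: "X 0 \<omega> = X0" and B_blocks: "B t \<omega> \<in> blocks"
    and V_argmin: "V t \<omega> \<in> argmin_V f gradf h Q \<alpha> (X t \<omega>) (B t \<omega>)"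
    and X_Suc: "X (Suc t) \<omega> = row_update (B t \<omega>) (V t \<omega>) (X t \<omega>)"
    if "\<omega> \<in> space M" for t \<omega>
    using run[OF that] by (auto simp: obcd_run_def row_update_def)
  have V_St: "V t \<omega> \<in> St" if "\<omega> \<in> space M" for t \<omega>
    using V_argmin[OF that] by (simp add: argmin_V_def is_arg_min_def)
  have X_St: "X t \<omega> \<in> St" if "\<omega> \<in> space M" for t \<omega>
    using that
    by (induction t) (simp_all add: X_0 X0 X_Suc row_update_in_St blocks_inj B_blocks V_St)
  have F_Suc: "F (X (Suc t) \<omega>) + ereal (\<alpha> / 2 * d t \<omega>) \<le> F (X t \<omega>)" if "\<omega> \<in> space M" for t \<omega>
    unfolding F_def X_Suc[OF that] d_def
    by (intro objective_row_update_argmin[OF descent Q_adm] X_St B_blocks V_argmin that)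
  have dX: "norm (X (Suc t) \<omega> - X t \<omega>) \<le> norm (V t \<omega> - mat 1)" if "\<omega> \<in> space M" for t \<omega>
    unfolding X_Suc[OF that]
    by (intro norm_row_update_diff_le blocks_inj B_blocks X_St that)
  have "\<alpha> / 2 * (norm (X (Suc t) \<omega> - X t \<omega>))\<^sup>2 \<le> \<alpha> / 2 * d t \<omega>" if "\<omega> \<in> space M" for t \<omega>
    unfolding d_def using \<alpha>_pos dX[OF that] by (intro mult_left_mono power_mono) auto
  \<comment> \<open>By \<open>F_Suc\<close> an infinite new value forces an infinite old one, and in
    that case the difference is \<infinity>, since \<infinity> - \<infinity> is \<infinity>
    here.\<close>
  moreover have "ereal (\<alpha> / 2 * d t \<omega>) \<le> F (X t \<omega>) - F (X (Suc t) \<omega>)" if "\<omega> \<in> space M" for t \<omega>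
    using F_Suc[OF that, of t] F_MInf[of "X (Suc t) \<omega>"]
    by (cases "F (X t \<omega>)"; cases "F (X (Suc t) \<omega>)") auto
  moreover have "c \<ge> 0"
    unfolding c_def using \<alpha>_pos Finf_le[OF X0] by (simp add: ereal_diff_positive)
  moreover have "\<exists>t\<le>T. integrable M (\<lambda>\<omega>. BS_gap f gradf h Q \<alpha> (X t \<omega>)) \<and>
                 (\<integral>\<omega>. BS_gap f gradf h Q \<alpha> (X t \<omega>) \<partial>M) \<le> \<epsilon>"
    if M: "prob_space M" and na: "nonanticipating M \<F> Q B V X" and us: "uniform_selection M \<F> B"
      and \<epsilon>: "\<epsilon> > 0" and T: "ereal (real T) \<ge> c / ereal \<epsilon>" for \<F> \<epsilon> T
  proof -
    interpret prob_space M by (rule M)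
    interpret filtration "space M" \<F> using na by (simp add: nonanticipating_def)
    \<comment> \<open>An infinite starting value would make \<open>c\<close> infinite, and no
      natural number \<open>T\<close> meets the bound then.\<close>
    have F0: "F X0 \<noteq> \<infinity>"
    proof
      assume "F X0 = \<infinity>"
      then have "c = \<infinity>" using \<alpha>_pos by (simp add: c_def)
      then show False using T \<epsilon> by simp
    qed
    obtain f0 fi where f0: "F X0 = ereal f0" and fi: "Finf = ereal fi"
      using F0 F_MInf[of X0] Finf_gt Finf_le[OF X0] by (cases "F X0"; cases Finf) auto
    have budget: "2 / \<alpha> * (f0 - fi) \<le> \<epsilon> * T"
    proof -
      have "2 / \<alpha> * (f0 - fi) / \<epsilon> \<le> T"
        using T \<epsilon> by (simp add: c_def f0 fi)
      then show ?thesis using \<epsilon> by (simp only: pos_divide_le_eq mult.commute[of \<epsilon>])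
    qed
    have F_fin: "F (X t \<omega>) \<noteq> \<infinity>" if "\<omega> \<in> space M" for t \<omega>
    proof (induction t)
      case (Suc t)
      then show ?case using F_Suc[OF that, of t] by auto
    qed (simp add: X_0 that F0)
    define g where "g t \<omega> = real_of_ereal (F (X t \<omega>))" for t \<omega>
    have g: "F (X t \<omega>) = ereal (g t \<omega>)" if "\<omega> \<in> space M" for t \<omega>
      using F_fin[OF that, of t] F_MInf[of "X t \<omega>"] by (cases "F (X t \<omega>)") (auto simp: g_def)
    have sum_d: "(\<Sum>t\<le>T. d t \<omega>) \<le> \<epsilon> * T" if "\<omega> \<in> space M" for \<omega>
    proof -
      have "\<alpha> / 2 * d t \<omega> \<le> g t \<omega> - g (Suc t) \<omega>" for t
        using F_Suc[OF that, of t] by (simp add: g that)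
      then have "(\<Sum>t\<le>T. \<alpha> / 2 * d t \<omega>) \<le> (\<Sum>t\<le>T. g t \<omega> - g (Suc t) \<omega>)"
        by (intro sum_mono)
      also have "\<dots> = g 0 \<omega> - g (Suc T) \<omega>"
        by (rule sum_telescope)
      also have "\<dots> \<le> f0 - fi"
        using Finf_le[OF X_St[OF that]] f0 fi by (simp add: g that flip: X_0[OF that])
      finally have "\<alpha> / 2 * (\<Sum>t\<le>T. d t \<omega>) \<le> f0 - fi"
        by (simp add: sum_distrib_left)
      then have "(\<Sum>t\<le>T. d t \<omega>) \<le> 2 / \<alpha> * (f0 - fi)"
        using \<alpha>_pos by (simp add: field_simps)
      then show ?thesis using budget by linarith
    qed
    have V_meas: "V t \<in> borel_measurable (\<F> (Suc t))" and B_meas: "B t \<in> \<F> (Suc t) \<rightarrow>\<^sub>M count_space blocks"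
      and Q_meas: "b \<in> blocks \<Longrightarrow> (\<lambda>\<omega>. Q (X t \<omega>) b) \<in> borel_measurable (\<F> t)"
      and sets_M: "sets (\<F> t) \<subseteq> sets M" for t b
      using na by (auto simp: nonanticipating_def)
    \<comment> \<open>The iterate is known before \<open>B t\<close> is drawn, which is what makes
      \<open>\<phi> t b\<close> independent of \<open>B t\<close>. In the induction, the update is a
      continuous function of \<open>U (B t \<omega>)\<close>, \<open>V t \<omega>\<close> and
      \<open>X t \<omega>\<close>.\<close>
    have X_meas: "X t \<in> borel_measurable (\<F> t)" for t
    proof (induction t)
      case 0
      show ?case
        by (rule measurable_cong[THEN iffD2, of _ _ "\<lambda>_. X0"]) (simp_all add: space_F X_0)
    next
      case (Suc t)
      have 1: "X t \<in> borel_measurable (\<F> (Suc t))"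
        using Suc sets_F_mono[of t "Suc t"]
        by (intro measurable_from_subalg[of "\<F> (Suc t)" "\<F> t"]) (auto simp: subalgebra_def space_F)
      have 2: "(\<lambda>\<omega>. U (B t \<omega>)) \<in> borel_measurable (\<F> (Suc t))"
        by (rule measurable_compose[OF B_meas]) simp
      have "continuous_on UNIV (\<lambda>p :: ('n, 'k) rmat \<times> ('k, 'k) rmat \<times> ('n, 'r) rmat.
          snd (snd p) + fst p ** (fst (snd p) - mat 1) ** transpose (fst p) ** snd (snd p))"
        by (intro continuous_intros)
      from measurable_compose[OF borel_measurable_Pair[OF 2 borel_measurable_Pair[OF V_meas 1]]
          borel_measurable_continuous_onI[OF this]]
      have "(\<lambda>\<omega>. row_update (B t \<omega>) (V t \<omega>) (X t \<omega>)) \<in> borel_measurable (\<F> (Suc t))"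
        by (simp add: row_update_def)
      then show ?case
        by (rule measurable_cong[THEN iffD2, rotated]) (simp add: space_F X_Suc)
    qed
    \<comment> \<open>All elements of \<open>St\<close> of this size have the norm of the identity,
      so none is farther from it than twice that norm. This uniform bound gives
      integrability.\<close>
    define K where "K = (2 * norm (mat 1 :: ('k, 'k) rmat))\<^sup>2"
    have St_le: "norm (W - mat 1) \<le> 2 * norm (mat 1 :: ('k, 'k) rmat)" if "W \<in> St" for W :: "('k, 'k) rmat"
      using norm_St_mult[OF that, of "mat 1"] norm_triangle_ineq4[of W "mat 1"] by simp
    have \<phi>_le: "\<phi> t b \<omega> \<le> (norm (W - mat 1))\<^sup>2"
      if "W \<in> argmin_V f gradf h Q \<alpha> (X t \<omega>) b" for t b \<omega> W
      unfolding \<phi>_def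
      using infdist_le[OF that, of "mat 1"]
      by (intro power_mono infdist_nonneg) (simp add: dist_norm norm_minus_commute)
    have \<phi>_bound: "norm (\<phi> t b \<omega>) \<le> K" if b: "b \<in> blocks" and \<omega>: "\<omega> \<in> space M" for t b \<omega>
    proof -
      obtain W where W: "W \<in> argmin_V f gradf h Q \<alpha> (X t \<omega>) b"
        using solvable[OF X_St[OF \<omega>] b] by blast
      then have "W \<in> St" by (simp add: argmin_V_def is_arg_min_def)
      then have "(norm (W - mat 1))\<^sup>2 \<le> K"
        unfolding K_def by (intro power_mono St_le) auto
      then have "\<phi> t b \<omega> \<le> K"
        using \<phi>_le[OF W] by linarith
      then show ?thesis by (simp add: \<phi>_def)
    qed
    have \<phi>_meas: "\<phi> t b \<in> borel_measurable (\<F> t)" if "b \<in> blocks" for t b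
      unfolding \<phi>_def[abs_def]
      by (intro borel_measurable_power borel_measurable_infdist_argmin_V h_lsc' h_MInf grad X_meas Q_meas that)
    have B_M: "B t \<in> M \<rightarrow>\<^sub>M count_space blocks"
      and B_unif: "distr M (count_space blocks) (B t) = uniform_count_measure blocks"
      and B_indep: "indep_set (sets (vimage_algebra (space M) (B t) (count_space blocks))) (sets (\<F> t))" for t
      using us by (auto simp: uniform_selection_def)
    have E: "integrable M (\<lambda>\<omega>. \<phi> t (B t \<omega>) \<omega>)"
      "expectation (\<lambda>\<omega>. \<phi> t (B t \<omega>) \<omega>)
        = (\<Sum>b\<in>blocks. expectation (\<phi> t b)) / card (blocks :: ('k \<Rightarrow> 'n) set)"
      "b \<in> blocks \<Longrightarrow> integrable M (\<phi> t b)" for t b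
      using uniform_indep_expectation[where \<phi> = "\<phi> t" and K = K,
          OF finite B_M B_unif B_indep space_F \<phi>_meas \<phi>_bound]
      by blast+
    have int_d: "integrable M (d t)" for t
    proof (rule integrable_const_bound[of _ K])
      have "V t \<in> borel_measurable M"
        using V_meas sets_M by (intro measurable_from_subalg[of M "\<F> (Suc t)"]) (auto simp: subalgebra_def space_F)
      then show "d t \<in> borel_measurable M"
        unfolding d_def[abs_def] by measurable
      show "AE \<omega> in M. norm (d t \<omega>) \<le> K"
      proof (rule AE_I2)
        fix \<omega> assume \<omega>: "\<omega> \<in> space M"
        have "d t \<omega> \<le> K"
          unfolding d_def K_def by (intro power_mono St_le V_St \<omega>) simp
        then show "norm (d t \<omega>) \<le> K" by (simp add: d_def)
      qed
    qed
    have gap_eq: "BS_gap f gradf h Q \<alpha> (X t \<omega>)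
        = (\<Sum>b\<in>blocks. \<phi> t b \<omega>) / (CARD('n) choose CARD('k))" for t \<omega>
      by (simp add: BS_gap_def \<phi>_def)
    have int_gap: "integrable M (\<lambda>\<omega>. BS_gap f gradf h Q \<alpha> (X t \<omega>))" for t
      unfolding gap_eq by (intro integrable_divide_zero Bochner_Integration.integrable_sum E(3))
    have E_gap: "expectation (\<lambda>\<omega>. BS_gap f gradf h Q \<alpha> (X t \<omega>)) \<le> expectation (d t)" for t
    proof -
      \<comment> \<open>The run itself supplies a block, so both denominators below are
        positive.\<close>
      obtain \<omega> where "\<omega> \<in> space M" using not_empty by blast
      then have "card (blocks :: ('k \<Rightarrow> 'n) set) > 0"
        using B_blocks by (auto simp: card_gt_0_iff)
      moreover have "0 \<le> (\<Sum>b\<in>blocks. expectation (\<phi> t b))"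
        by (intro sum_nonneg integral_nonneg_AE) (simp add: \<phi>_def)
      ultimately have "(\<Sum>b\<in>blocks. expectation (\<phi> t b)) / (CARD('n) choose CARD('k))
          \<le> (\<Sum>b\<in>blocks. expectation (\<phi> t b)) / card (blocks :: ('k \<Rightarrow> 'n) set)"
        using card_blocks_le[where ?'k = 'k and ?'n = 'n]
        by (intro divide_left_mono mult_pos_pos) (simp_all del: zero_less_binomial_iff)
      also have "\<dots> = expectation (\<lambda>\<omega>. \<phi> t (B t \<omega>) \<omega>)"
        by (rule E(2)[symmetric])
      \<comment> \<open>The computed \<open>V t \<omega>\<close> is one member of the argmin set of
        the drawn block, so its distance to the identity bounds the infimum.\<close>
      also have "\<dots> \<le> expectation (d t)"
      proof (rule integral_mono[OF E(1) int_d])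
        fix \<omega> assume "\<omega> \<in> space M"
        then show "\<phi> t (B t \<omega>) \<omega> \<le> d t \<omega>"
          unfolding d_def by (intro \<phi>_le V_argmin)
      qed
      finally show ?thesis
        unfolding gap_eq by (simp add: E(3))
    qed
    have "\<exists>t\<le>T. expectation (\<lambda>\<omega>. BS_gap f gradf h Q \<alpha> (X t \<omega>)) \<le> \<epsilon>"
    \<comment> \<open>There are \<open>T + 1\<close> indices but the total budget is only
      \<open>\<epsilon> * T\<close>, so not every expected gap can exceed \<epsilon>; this one spare
      index also covers \<open>T = 0\<close>.\<close>
    proof (rule ccontr)
      assume "\<not> ?thesis"
      then have "\<epsilon> \<le> expectation (d t)" if "t \<le> T" for t
        using E_gap[of t] that by fastforce
      then have "real (card {..T}) * \<epsilon> \<le> (\<Sum>t\<le>T. expectation (d t))"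
        by (intro sum_bounded_below) auto
      also have "\<dots> = expectation (\<lambda>\<omega>. \<Sum>t\<le>T. d t \<omega>)"
        by (simp add: int_d)
      also have "\<dots> \<le> \<epsilon> * T"
        using sum_d by (intro integral_le_const AE_I2 Bochner_Integration.integrable_sum int_d)
      finally show False using \<epsilon> by (simp add: algebra_simps)
    qed
    then show ?thesis using int_gap by blast
  qed
  ultimately show ?thesis unfolding d_def by blast
qed

end
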